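(* Let $X$ and $Y$ be real Banach spaces and let $\beta_X$ and $\beta_Y$ be vector bornologies on $X$ and $Y$ respectively. Assume that $\beta_X$ satisfies property $(S)$, and let $T:Y\to X$ be a (not necessarily linear) map that is $\beta_Y$-p.h. differentiable at $y\in Y$. Then the following assertions are equivalent. (i) $d_{\beta_Y}^{ph}T(y)$ is a $\beta_Y$-$\beta_X$-operator. (ii) For every Lipschitz function $f:X\to\mathbb{R}$ that is $\beta_X$-p.h. differentiable at $x=Ty$, the function $f\circ T$ is $\beta_Y$-p.h. differentiable at $y$ and $d_{\beta_Y}^{ph}(f\circ T)(y)=d_{\beta_X}^{ph}f(x)\circ d_{\beta_Y}^{ph}T(y)$. (iii) For every Lipschitz function $f:X\to\mathbb{R}$ that is $\beta_X$-differentiable at $x=Ty$ with $d_{\beta_X}f(x)=0$, the function $f\circ T$ is $\beta_Y$-differentiable at $y$ and $d_{\beta_Y}(f\circ T)(y)=0$.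
   Context: A bornology on a real Banach space $X$ is a family $\beta$ of nonempty bounded subsets of $X$ such that $\bigcup_{A\in\beta}A=X$; $A\cup B\in\beta$ for all $A,B\in\beta$; and every nonempty $B\subset A$ with $A\in\beta$ belongs to $\beta$. It is a vector bornology if moreover, for every $A\in\beta$, $\lambda\in\mathbb{R}$ and $x\in X$, one has $\mathrm{bal}(A):=\{\mu a: a\in A,\ |\mu|\le 1\}\in\beta$ and $x+\lambda A\in\beta$. A vector bornology $\beta$ on $X$ satisfies property $(S)$ if for every nonempty bounded set $A\subset X$ with $A\notin\beta$ there are a sequence $(x_n)_n\subset A$ and $\delta>0$ such that for every increasing sequence $(n_k)_k\subset\mathbb{N}$ and every sequence $(y_k)_k\subset X$ with $\|y_k-x_{n_k}\|\le\delta$ for all $k$, the set $\{y_k:k\in\mathbb{N}\}$ does not belong to $\beta$. A map $R:Y\to X$ (not necessarily linear) is a $\beta_Y$-$\beta_X$-operator if $R(A)\in\beta_X$ for all $A\in\beta_Y$. Let $\beta$ be a bornology on a Banach space $Y$ and $Z$ a Banach space. A map $T:Y\to Z$ is $\beta$-differentiable at $y$ if there is a bounded linear operator $d_\beta T(y):Y\to Z$ with $\lim_{t\to0}\sup_{u\in A}\left\|\frac{T(y+tu)-T(y)}{t}-d_\beta T(y)(u)\right\|=0$ for all $A\in\beta$. It is $\beta$-p.h. differentiable (positively homogeneous differentiable) at $y$ if there is a continuous positively homogeneous map $R:Y\to Z$ with $\lim_{t\to0^+}\sup_{u\in A}\left\|\frac{T(y+tu)-T(y)}{t}-R(u)\right\|=0$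 for all $A\in\beta$; this $R$ is unique and denoted $d_\beta^{ph}T(y)$. *)

theory Defs
  imports "HOL-Analysis.Analysis"
begin

definition bornology :: "'a::real_normed_vector set set \<Rightarrow> bool" where
  "bornology \<beta> \<longleftrightarrow>
     (\<forall>A\<in>\<beta>. A \<noteq> {} \<and> bounded A) \<and>
     \<Union>\<beta> = UNIV \<and>
     (\<forall>A\<in>\<beta>. \<forall>B\<in>\<beta>. A \<union> B \<in> \<beta>) \<and>
     (\<forall>A\<in>\<beta>. \<forall>B. B \<noteq> {} \<longrightarrow> B \<subseteq> A \<longrightarrow> B \<in> \<beta>)"

definition bal :: "'a::real_vector set \<Rightarrow> 'a set" where
  "bal A = {\<mu> *\<^sub>R a | \<mu> a. a \<in> A \<and> \<bar>\<mu>\<bar> \<le> 1}"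

definition vector_bornology :: "'a::real_normed_vector set set \<Rightarrow> bool" where
  "vector_bornology \<beta> \<longleftrightarrow>
     bornology \<beta> \<and>
     (\<forall>A\<in>\<beta>. \<forall>(c::real) x. bal A \<in> \<beta> \<and> (\<lambda>a. x + c *\<^sub>R a) ` A \<in> \<beta>)"

text \<open>
  In the following definition, increasing means strictly increasing: constant index
  sequences must be excluded, since singletons belong to every bornology.
\<close>

definition property_S :: "'a::real_normed_vector set set \<Rightarrow> bool" where
  "property_S \<beta> \<longleftrightarrow>
     (\<forall>A. A \<noteq> {} \<longrightarrow> bounded A \<longrightarrow> A \<notin> \<beta> \<longrightarrow>
        (\<exists>(x :: nat \<Rightarrow> 'a) (\<delta>::real). range x \<subseteq> A \<and> \<delta> > 0 \<and>
           (\<forall>(n :: nat \<Rightarrow> nat) (y :: nat \<Rightarrow> 'a).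
              strict_mono n \<longrightarrow> (\<forall>k. norm (y k - x (n k)) \<le> \<delta>) \<longrightarrow> range y \<notin> \<beta>)))"

definition bornology_operator :: "'b set set \<Rightarrow> 'a set set \<Rightarrow> ('b \<Rightarrow> 'a) \<Rightarrow> bool" where
  "bornology_operator \<beta>Y \<beta>X R \<longleftrightarrow> (\<forall>A\<in>\<beta>Y. R ` A \<in> \<beta>X)"

definition positively_homogeneous :: "('b::real_vector \<Rightarrow> 'c::real_vector) \<Rightarrow> bool" where
  "positively_homogeneous R \<longleftrightarrow> (\<forall>t\<ge>0. \<forall>u. R (t *\<^sub>R u) = t *\<^sub>R R u)"

text \<open>
  The suprema below are taken in the extended reals, because the difference quotient of an
  arbitrary map may be unbounded on \<open>A\<close>.
\<close>

definition has_born_deriv ::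
  "'b::real_normed_vector set set \<Rightarrow> ('b \<Rightarrow> 'c::real_normed_vector) \<Rightarrow> 'b \<Rightarrow> ('b \<Rightarrow> 'c) \<Rightarrow> bool"
  where
  "has_born_deriv \<beta> T y D \<longleftrightarrow>
     bounded_linear D \<and>
     (\<forall>A\<in>\<beta>. ((\<lambda>t::real. SUP u\<in>A. ereal (norm ((T (y + t *\<^sub>R u) - T y) /\<^sub>R t - D u)))
        \<longlongrightarrow> 0) (at 0))"

definition has_ph_deriv ::
  "'b::real_normed_vector set set \<Rightarrow> ('b \<Rightarrow> 'c::real_normed_vector) \<Rightarrow> 'b \<Rightarrow> ('b \<Rightarrow> 'c) \<Rightarrow> bool"
  where
  "has_ph_deriv \<beta> T y R \<longleftrightarrow>
     continuous_on UNIV R \<and> positively_homogeneous R \<and>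
     (\<forall>A\<in>\<beta>. ((\<lambda>t::real. SUP u\<in>A. ereal (norm ((T (y + t *\<^sub>R u) - T y) /\<^sub>R t - R u)))
        \<longlongrightarrow> 0) (at_right 0))"

definition born_differentiable ::
  "'b::real_normed_vector set set \<Rightarrow> ('b \<Rightarrow> 'c::real_normed_vector) \<Rightarrow> 'b \<Rightarrow> bool" where
  "born_differentiable \<beta> T y \<longleftrightarrow> (\<exists>D. has_born_deriv \<beta> T y D)"

definition ph_differentiable ::
  "'b::real_normed_vector set set \<Rightarrow> ('b \<Rightarrow> 'c::real_normed_vector) \<Rightarrow> 'b \<Rightarrow> bool" where
  "ph_differentiable \<beta> T y \<longleftrightarrow> (\<exists>R. has_ph_deriv \<beta> T y R)"

text \<open>
  Both derivatives are unique when \<open>\<beta>\<close> is a bornology; see \<open>born_deriv_eqI\<close> and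
  \<open>ph_deriv_eqI\<close> below. Without differentiability the values are meaningless.
\<close>

definition born_deriv ::
  "'b::real_normed_vector set set \<Rightarrow> ('b \<Rightarrow> 'c::real_normed_vector) \<Rightarrow> 'b \<Rightarrow> 'b \<Rightarrow> 'c" where
  "born_deriv \<beta> T y = (THE D. has_born_deriv \<beta> T y D)"

definition ph_deriv ::
  "'b::real_normed_vector set set \<Rightarrow> ('b \<Rightarrow> 'c::real_normed_vector) \<Rightarrow> 'b \<Rightarrow> 'b \<Rightarrow> 'c" where
  "ph_deriv \<beta> T y = (THE R. has_ph_deriv \<beta> T y R)"

lemma tendsto_SUP_norm_iff_uniform_limit:
  fixes q :: "'t \<Rightarrow> 'b \<Rightarrow> 'c::real_normed_vector"
  assumes "A \<noteq> {}"
  shows "((\<lambda>t. SUP u\<in>A. ereal (norm (q t u - R u))) \<longlongrightarrow> 0) F \<longleftrightarrow> uniform_limit A q R F"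
    (is "(?S \<longlongrightarrow> 0) F \<longleftrightarrow> _")
proof
  assume L: "(?S \<longlongrightarrow> 0) F"
  show "uniform_limit A q R F"
  proof (rule uniform_limitI)
    fix e :: real assume "e > 0"
    then have "\<forall>\<^sub>F t in F. ?S t < ereal e"
      using order_tendstoD(2)[OF L, of "ereal e"] by simp
    then show "\<forall>\<^sub>F t in F. \<forall>u\<in>A. dist (q t u) (R u) < e"
    proof eventually_elim
      case (elim t)
      show ?case
      proof
        fix u assume "u \<in> A"
        then have "ereal (norm (q t u - R u)) \<le> ?S t" by (rule SUP_upper)
        then have "ereal (norm (q t u - R u)) < ereal e" using elim by (rule le_less_trans)
        then show "dist (q t u) (R u) < e" by (simp add: dist_norm)
      qed
    qed
  qed
next
  assume U: "uniform_limit A q R F"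
  have nonneg: "0 \<le> ?S t" for t
  proof -
    obtain u where "u \<in> A" using assms by blast
    then have "ereal (norm (q t u - R u)) \<le> ?S t" by (rule SUP_upper)
    moreover have "0 \<le> ereal (norm (q t u - R u))" by simp
    ultimately show ?thesis by (rule order_trans[rotated])
  qed
  show "(?S \<longlongrightarrow> 0) F"
  proof (rule order_tendstoI)
    fix a :: ereal assume "a < 0"
    then show "\<forall>\<^sub>F t in F. a < ?S t" using nonneg by (intro always_eventually) (meson less_le_trans)
  next
    fix a :: ereal assume "0 < a"
    then obtain e where e: "0 < ereal e" "ereal e < a" using ereal_dense2 by blast
    then have "\<forall>\<^sub>F t in F. \<forall>u\<in>A. dist (q t u) (R u) < e"
      using uniform_limitD[OF U, of e] by simp
    then show "\<forall>\<^sub>F t in F. ?S t < a"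
    proof eventually_elim
      case (elim t)
      have "?S t \<le> ereal e"
        using elim by (intro SUP_least) (auto simp: dist_norm intro: less_imp_le)
      then show ?case using e(2) by (rule le_less_trans)
    qed
  qed
qed

lemma bornology_singleton: "bornology \<beta> \<Longrightarrow> {u} \<in> \<beta>"
proof -
  assume b: "bornology \<beta>"
  then obtain A where "A \<in> \<beta>" "u \<in> A" unfolding bornology_def by blast
  with b show ?thesis unfolding bornology_def by blast
qed

lemma born_deriv_eqI:
  assumes "bornology \<beta>" "has_born_deriv \<beta> T y D"
  shows "born_deriv \<beta> T y = D"
proof -
  have *: "((\<lambda>t. (T (y + t *\<^sub>R u) - T y) /\<^sub>R t) \<longlongrightarrow> E u) (at 0)"
    if "has_born_deriv \<beta> T y E" for E u
  proof -
    have "uniform_limit {u} (\<lambda>t u. (T (y + t *\<^sub>R u) - T y) /\<^sub>R t) E (at 0)"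
    proof (rule tendsto_SUP_norm_iff_uniform_limit[THEN iffD1])
      show "((\<lambda>t. SUP v\<in>{u}. ereal (norm ((T (y + t *\<^sub>R v) - T y) /\<^sub>R t - E v)))
          \<longlongrightarrow> 0) (at 0)"
        using that bornology_singleton[OF assms(1), of u] unfolding has_born_deriv_def by blast
    qed simp
    then show ?thesis by (rule tendsto_uniform_limitI) simp
  qed
  have "E = D" if "has_born_deriv \<beta> T y E" for E
    by (rule ext, rule tendsto_unique[OF at_neq_bot *[OF that] *[OF assms(2)]])
  with assms(2) show ?thesis unfolding born_deriv_def by (intro the_equality)
qed

lemma ph_deriv_eqI:
  assumes "bornology \<beta>" "has_ph_deriv \<beta> T y R"
  shows "ph_deriv \<beta> T y = R"
proof -
  have *: "((\<lambda>t. (T (y + t *\<^sub>R u) - T y) /\<^sub>R t) \<longlongrightarrow> E u) (at_right 0)"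
    if "has_ph_deriv \<beta> T y E" for E u
  proof -
    have "uniform_limit {u} (\<lambda>t u. (T (y + t *\<^sub>R u) - T y) /\<^sub>R t) E (at_right 0)"
    proof (rule tendsto_SUP_norm_iff_uniform_limit[THEN iffD1])
      show "((\<lambda>t. SUP v\<in>{u}. ereal (norm ((T (y + t *\<^sub>R v) - T y) /\<^sub>R t - E v)))
          \<longlongrightarrow> 0) (at_right 0)"
        using that bornology_singleton[OF assms(1), of u] unfolding has_ph_deriv_def by blast
    qed simp
    then show ?thesis by (rule tendsto_uniform_limitI) simp
  qed
  have "E = R" if "has_ph_deriv \<beta> T y E" for E
    by (rule ext, rule tendsto_unique[OF trivial_limit_at_right_real *[OF that] *[OF assms(2)]])
  with assms(2) show ?thesis unfolding ph_deriv_def by (intro the_equality)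
qed

end

theory Submission imports Defs begin

text \<open>
  The implication from (i) to (ii) is the chain rule for Lipschitz functions, and (iii) follows
  from (ii) since \<open>\<beta>Y\<close> is stable under \<open>A \<mapsto> -A\<close>. For (iii) implies (i), suppose that the
  derivative \<open>R\<close> of \<open>T\<close> maps some \<open>A \<in> \<beta>Y\<close> outside \<open>\<beta>X\<close>. Property (S) gives points
  \<open>v n = R (u n)\<close> with \<open>u n \<in> A\<close> and \<open>\<delta> > 0\<close> such that every \<open>C \<in> \<beta>X\<close> meets only finitely many of
  the balls of radius \<open>\<delta>\<close> around the \<open>v n\<close>; applied to \<open>C = {0}\<close> this allows to assume
  \<open>norm (v n) > \<delta>\<close> for all \<open>n\<close>. With \<open>t n = 1/(n+1)\<close>, let \<open>f\<close> be the supremum of the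
  cones of slope 1 and height \<open>\<delta> t n\<close> with apex over \<open>T y + t n v n\<close>.
  Each single cone vanishes near \<open>T y\<close>. If \<open>f (T y + s w) > \<epsilon> |s|\<close>
  then \<open>T y + s w\<close> lies below some cone with \<open>|s| / t n < \<delta> / \<epsilon>\<close>, so that \<open>(s / t n) w\<close> is
  \<open>\<delta>\<close>-close to \<open>v n\<close>, which leaves finitely many \<open>n\<close> for \<open>w\<close> in a set of \<open>\<beta>X\<close>; hence \<open>f\<close> has derivative \<open>0\<close> at \<open>T y\<close>. The quotients of \<open>f \<circ> T\<close>
  along \<open>t n u n\<close>, however, stay close to or above \<open>\<delta>\<close>.
\<close>

section \<open>Vector bornologies, and both derivatives as uniform limits\<close>

lemma vector_bornologyD:
  assumes "vector_bornology \<beta>" "A \<in> \<beta>"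
  shows "bornology \<beta>" "bal A \<in> \<beta>" "(\<lambda>a. c *\<^sub>R a) ` A \<in> \<beta>"
proof -
  show "bornology \<beta>" "bal A \<in> \<beta>"
    using assms by (auto simp: vector_bornology_def)
  have "(\<lambda>a. 0 + c *\<^sub>R a) ` A \<in> \<beta>"
    using assms unfolding vector_bornology_def by blast
  then show "(\<lambda>a. c *\<^sub>R a) ` A \<in> \<beta>" by simp
qed

lemma has_ph_deriv_iff_uniform_limit:
  assumes "bornology \<beta>"
  shows "has_ph_deriv \<beta> T y R \<longleftrightarrow> continuous_on UNIV R \<and> positively_homogeneous R \<and>
    (\<forall>A\<in>\<beta>. uniform_limit A (\<lambda>t u. (T (y + t *\<^sub>R u) - T y) /\<^sub>R t) R (at_right 0))"
proof -
  \<comment> \<open>In \<open>ereal\<close> the supremum over the empty set is minus infinity, so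
    the translation into uniform limits needs nonempty sets.\<close>
  have "A \<noteq> {}" if "A \<in> \<beta>" for A
    using assms that by (auto simp: bornology_def)
  then show ?thesis
    unfolding has_ph_deriv_def by (simp add: tendsto_SUP_norm_iff_uniform_limit)
qed

lemma has_born_deriv_iff_uniform_limit:
  assumes "bornology \<beta>"
  shows "has_born_deriv \<beta> T y D \<longleftrightarrow> bounded_linear D \<and>
    (\<forall>A\<in>\<beta>. uniform_limit A (\<lambda>t u. (T (y + t *\<^sub>R u) - T y) /\<^sub>R t) D (at 0))"
proof -
  have "A \<noteq> {}" if "A \<in> \<beta>" for A
    using assms that by (auto simp: bornology_def)
  then show ?thesis
    unfolding has_born_deriv_def by (simp add: tendsto_SUP_norm_iff_uniform_limit)
qed

lemma has_born_deriv_imp_has_ph_deriv: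
  assumes b: "bornology \<beta>" and D: "has_born_deriv \<beta> T y D"
  shows "has_ph_deriv \<beta> T y D"
proof -
  have lin: "bounded_linear D"
    and U: "\<And>A. A \<in> \<beta> \<Longrightarrow> uniform_limit A (\<lambda>t u. (T (y + t *\<^sub>R u) - T y) /\<^sub>R t) D (at 0)"
    using D unfolding has_born_deriv_iff_uniform_limit[OF b] by auto
  have "continuous_on UNIV D"
    using lin by (rule linear_continuous_on)
  moreover have "positively_homogeneous D"
    using lin by (auto simp: positively_homogeneous_def linear_cmul bounded_linear.linear)
  moreover have "uniform_limit A (\<lambda>t u. (T (y + t *\<^sub>R u) - T y) /\<^sub>R t) D (at_right 0)"
    if "A \<in> \<beta>" for A
    using U[OF that] unfolding uniform_limit_iff eventually_at_split by blast
  ultimately show ?thesis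
    unfolding has_ph_deriv_iff_uniform_limit[OF b] by blast
qed

text \<open>Substituting \<open>- u\<close> for \<open>u\<close> turns the quotient at
  \<open>- t\<close> into minus the quotient at \<open>t\<close>, and \<open>D\<close> is odd by
  linearity. Convergence from the left on \<open>A\<close> is therefore convergence from the right
  on \<open>- A\<close>, which is again in \<beta>.\<close>

lemma has_ph_deriv_imp_has_born_deriv:
  assumes v: "vector_bornology \<beta>" and D: "has_ph_deriv \<beta> T y D" and lin: "bounded_linear D"
  shows "has_born_deriv \<beta> T y D"
proof -
  have b: "bornology \<beta>" using v by (simp add: vector_bornology_def)
  let ?q = "\<lambda>t u. (T (y + t *\<^sub>R u) - T y) /\<^sub>R t"
  have "uniform_limit A ?q D (at 0)" if A: "A \<in> \<beta>" for A
  proof (rule uniform_limitI)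
    fix e :: real assume "e > 0"
    have ev: "\<forall>\<^sub>F t in at_right 0. \<forall>u\<in>B. dist (?q t u) (D u) < e" if "B \<in> \<beta>" for B
      using D that \<open>e > 0\<close> unfolding has_ph_deriv_iff_uniform_limit[OF b] uniform_limit_iff
      by blast
    have "\<forall>\<^sub>F t in at_right 0. \<forall>u\<in>A. dist (?q (- t) u) (D u) < e"
      using ev[OF vector_bornologyD(3)[OF v A, of "-1"]]
    proof eventually_elim
      case (elim t)
      show ?case
      proof
        fix u assume "u \<in> A"
        then have "dist (?q t (- u)) (D (- u)) < e" using elim by simp
        moreover have "?q t (- u) = - ?q (- t) u" by (simp add: scaleR_diff_right)
        moreover have "D (- u) = - D u" using lin by (simp add: linear_neg bounded_linear.linear)
        ultimately show "dist (?q (- t) u) (D u) < e" by (metis dist_minus)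
      qed
    qed
    then have "\<forall>\<^sub>F t in at_left 0. \<forall>u\<in>A. dist (?q t u) (D u) < e"
      using at_left_minus[of "0::real"] by (simp add: eventually_filtermap)
    then show "\<forall>\<^sub>F t in at 0. \<forall>u\<in>A. dist (?q t u) (D u) < e"
      using ev[OF A] unfolding eventually_at_split by blast
  qed
  with lin show ?thesis unfolding has_born_deriv_iff_uniform_limit[OF b] by blast
qed

section \<open>Positively homogeneous maps and the chain rule for Lipschitz functions\<close>

lemma positively_homogeneous_compose:
  "positively_homogeneous F \<Longrightarrow> positively_homogeneous R \<Longrightarrow> positively_homogeneous (F \<circ> R)"
  by (simp add: positively_homogeneous_def)

text \<open>Continuity at 0 bounds \<open>R\<close> on a small ball, and homogeneity carries this
  bound to any multiple of the ball. Property (S) speaks of bounded sets only, so this makes it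
  applicable to images under \<open>R\<close>.\<close>

lemma positively_homogeneous_bounded_image:
  fixes R :: "'a::real_normed_vector \<Rightarrow> 'b::real_normed_vector"
  assumes "positively_homogeneous R" "continuous_on UNIV R" "bounded A"
  shows "bounded (R ` A)"
proof -
  have R0: "R 0 = 0"
    using assms(1) unfolding positively_homogeneous_def by (metis order_refl scale_zero_left)
  have "continuous (at 0) R"
    using assms(2) by (simp add: continuous_on_eq_continuous_at)
  then obtain d where d: "d > 0" "\<And>u. norm u < d \<Longrightarrow> norm (R u) < 1"
    unfolding continuous_at_eps_delta using R0 by (metis diff_zero dist_norm zero_less_one)
  obtain M where M: "M > 0" "\<And>u. u \<in> A \<Longrightarrow> norm u \<le> M"
    using assms(3) bounded_pos by blast
  have "norm (R u) \<le> 2 * M / d" if "u \<in> A" for u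
  proof -
    \<comment> \<open>The factor 2 puts the rescaled vector strictly inside the ball of radius
      \<open>d\<close>.\<close>
    let ?c = "d / (2 * M)"
    have c: "?c > 0" using d M by simp
    have "norm (?c *\<^sub>R u) = ?c * norm u"
      using c by (simp only: norm_scaleR abs_of_pos)
    also have "\<dots> \<le> ?c * M" using c M(2)[OF that] by (intro mult_left_mono) auto
    also have "\<dots> < d" using d M by simp
    finally have "norm (R (?c *\<^sub>R u)) < 1" by (rule d(2))
    moreover have "R (?c *\<^sub>R u) = ?c *\<^sub>R R u"
      using assms(1) c unfolding positively_homogeneous_def by (meson less_imp_le)
    ultimately have "?c * norm (R u) < 1"
      using c by (simp only: norm_scaleR abs_of_pos)
    then show ?thesis using d M by (simp add: field_simps)
  qed
  then show ?thesis unfolding bounded_iff by blast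
qed

text \<open>Meant for \<open>a = T (y + t *\<^sub>R u)\<close>, \<open>x = T y\<close>,
  \<open>v = R u\<close> and \<open>c = f x\<close>: replacing the increment of \<open>T\<close> by
  its first-order part costs at most \<open>L\<close> times the error of \<open>T\<close>.\<close>

lemma lipschitz_quotient_dist:
  fixes f :: "'a::real_normed_vector \<Rightarrow> 'b::real_normed_vector"
  assumes "L-lipschitz_on UNIV f" "t > 0"
  shows "dist ((f a - c) /\<^sub>R t) ((f (x + t *\<^sub>R v) - c) /\<^sub>R t) \<le> L * dist ((a - x) /\<^sub>R t) v"
proof -
  have "dist ((f a - c) /\<^sub>R t) ((f (x + t *\<^sub>R v) - c) /\<^sub>R t) = dist (f a) (f (x + t *\<^sub>R v)) / t"
    using assms(2)
    by (simp add: dist_norm divide_inverse mult.commute flip: scaleR_diff_right)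
  also have "\<dots> \<le> L * dist a (x + t *\<^sub>R v) / t"
    using assms by (intro divide_right_mono lipschitz_onD[OF assms(1)]) auto
  also have "dist a (x + t *\<^sub>R v) = t * dist ((a - x) /\<^sub>R t) v"
  proof -
    have "a - (x + t *\<^sub>R v) = t *\<^sub>R ((a - x) /\<^sub>R t - v)"
      using assms(2) by (simp add: algebra_simps)
    then show ?thesis using assms(2) by (simp add: dist_norm)
  qed
  finally show ?thesis using assms(2) by simp
qed

lemma has_ph_deriv_compose:
  fixes f :: "'a::real_normed_vector \<Rightarrow> 'b::real_normed_vector"
    and T :: "'c::real_normed_vector \<Rightarrow> 'a"
  assumes bX: "bornology \<beta>X" and bY: "bornology \<beta>Y" and op: "bornology_operator \<beta>Y \<beta>X R"
    and L: "L-lipschitz_on UNIV f"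
    and T: "has_ph_deriv \<beta>Y T y R" and f: "has_ph_deriv \<beta>X f (T y) F"
  shows "has_ph_deriv \<beta>Y (f \<circ> T) y (F \<circ> R)"
proof -
  note iff = has_ph_deriv_iff_uniform_limit
  have "continuous_on UNIV (F \<circ> R)"
    using T f unfolding has_ph_deriv_def
    by (meson continuous_on_compose continuous_on_subset subset_UNIV)
  moreover have "positively_homogeneous (F \<circ> R)"
    using T f unfolding has_ph_deriv_def by (intro positively_homogeneous_compose) auto
  moreover have "uniform_limit A (\<lambda>t u. ((f \<circ> T) (y + t *\<^sub>R u) - (f \<circ> T) y) /\<^sub>R t) (F \<circ> R)
      (at_right 0)" if A: "A \<in> \<beta>Y" for A
  proof (rule uniform_limitI)
    fix e :: real assume e: "e > 0"
    have L0: "L \<ge> 0" using L by (rule lipschitz_on_nonneg)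
    \<comment> \<open>Dividing by \<open>L + 1\<close> also covers the case
      \<open>L = 0\<close>.\<close>
    have "e / 2 / (L + 1) > 0" using e L0 by simp
    then have T': "\<forall>\<^sub>F t in at_right 0. \<forall>u\<in>A.
        dist ((T (y + t *\<^sub>R u) - T y) /\<^sub>R t) (R u) < e / 2 / (L + 1)"
      using T A unfolding iff[OF bY] uniform_limit_iff by blast
    have "R ` A \<in> \<beta>X" using op A by (simp add: bornology_operator_def)
    moreover have "e / 2 > 0" using e by simp
    ultimately have f': "\<forall>\<^sub>F t in at_right 0. \<forall>v\<in>R ` A.
        dist ((f (T y + t *\<^sub>R v) - f (T y)) /\<^sub>R t) (F v) < e / 2"
      using f unfolding iff[OF bX] uniform_limit_iff by blast
    show "\<forall>\<^sub>F t in at_right 0. \<forall>u\<in>A.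
        dist (((f \<circ> T) (y + t *\<^sub>R u) - (f \<circ> T) y) /\<^sub>R t) ((F \<circ> R) u) < e"
      using T' f' eventually_at_right_less[of 0]
    proof eventually_elim
      case (elim t)
      show ?case
      proof
        fix u assume u: "u \<in> A"
        let ?p = "(f (T (y + t *\<^sub>R u)) - f (T y)) /\<^sub>R t"
          and ?q = "(f (T y + t *\<^sub>R R u) - f (T y)) /\<^sub>R t"
        have "dist ?p ?q \<le> L * dist ((T (y + t *\<^sub>R u) - T y) /\<^sub>R t) (R u)"
          using L elim(3) by (rule lipschitz_quotient_dist)
        also have "\<dots> \<le> (L + 1) * dist ((T (y + t *\<^sub>R u) - T y) /\<^sub>R t) (R u)"
          by (intro mult_right_mono) auto
        also have "\<dots> < (L + 1) * (e / 2 / (L + 1))"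
          using elim(1) u L0 by (intro mult_strict_left_mono) auto
        also have "\<dots> = e / 2"
          using L0 nonzero_mult_div_cancel_left[of "L + 1" "e / 2"] by simp
        finally have "dist ?p ?q < e / 2" .
        moreover have "dist ?q (F (R u)) < e / 2" using elim(2) u by blast
        ultimately have "dist ?p (F (R u)) < e"
          using dist_triangle[of ?p "F (R u)" ?q] by linarith
        then show "dist (((f \<circ> T) (y + t *\<^sub>R u) - (f \<circ> T) y) /\<^sub>R t) ((F \<circ> R) u) < e" by simp
      qed
    qed
  qed
  ultimately show ?thesis unfolding iff[OF bY] by blast
qed

section \<open>Separated sequences from property (S), and the supremum of cones\<close>

lemma lipschitz_on_SUP:
  fixes g :: "'i \<Rightarrow> 'a::metric_space \<Rightarrow> real"
  assumes "I \<noteq> {}" "\<And>z. bdd_above ((\<lambda>i. g i z) ` I)" "\<And>i. i \<in> I \<Longrightarrow> L-lipschitz_on S (g i)"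
    "L \<ge> 0"
  shows "L-lipschitz_on S (\<lambda>z. SUP i\<in>I. g i z)"
proof (rule lipschitz_onI)
  have le: "(SUP i\<in>I. g i z) \<le> (SUP i\<in>I. g i w) + L * dist z w" if "z \<in> S" "w \<in> S" for z w
  proof (rule cSUP_least[OF assms(1)])
    fix i assume i: "i \<in> I"
    have "dist (g i z) (g i w) \<le> L * dist z w"
      using assms(3)[OF i] that by (rule lipschitz_onD)
    then have "g i z \<le> g i w + L * dist z w" by (simp add: dist_real_def)
    moreover have "g i w \<le> (SUP i\<in>I. g i w)" by (intro cSUP_upper i assms(2))
    ultimately show "g i z \<le> (SUP i\<in>I. g i w) + L * dist z w" by linarith
  qed
  show "dist (SUP i\<in>I. g i z) (SUP i\<in>I. g i w) \<le> L * dist z w" if "z \<in> S" "w \<in> S" for z w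
    using le[OF that] le[OF that(2,1)] by (simp add: dist_real_def dist_commute abs_le_iff)
qed (rule assms(4))

text \<open>If infinitely many indices were close to \<open>C\<close>, their increasing enumeration
  would select a subsequence approximated within \<delta> by points of \<open>C\<close>. These
  points form a nonempty subset of \<open>C\<close>, hence a member of \<beta>, against (S).\<close>

lemma property_S_separated_sequence:
  fixes \<beta> :: "'a::real_normed_vector set set"
  assumes b: "bornology \<beta>" and S: "property_S \<beta>" and A: "A \<noteq> {}" "bounded A" "A \<notin> \<beta>"
  obtains v :: "nat \<Rightarrow> 'a" and \<delta> where "range v \<subseteq> A" "\<delta> > 0" "\<And>n. norm (v n) > \<delta>"
    "\<And>C. C \<in> \<beta> \<Longrightarrow> finite {n. \<exists>c\<in>C. norm (c - v n) \<le> \<delta>}"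
proof -
  obtain x :: "nat \<Rightarrow> 'a" and \<delta> where x: "range x \<subseteq> A" "\<delta> > 0"
    and sep: "\<forall>(n :: nat \<Rightarrow> nat) y. strict_mono n \<longrightarrow> (\<forall>k. norm (y k - x (n k)) \<le> \<delta>) \<longrightarrow> range y \<notin> \<beta>"
    using S[unfolded property_S_def, rule_format, OF A] by blast
  have fin: "finite {n. \<exists>c\<in>C. norm (c - x n) \<le> \<delta>}" (is "finite ?N") if C: "C \<in> \<beta>" for C
  proof (rule ccontr)
    assume inf: "infinite ?N"
    have "\<forall>k. \<exists>c. c \<in> C \<and> norm (c - x (enumerate ?N k)) \<le> \<delta>"
      using enumerate_in_set[OF inf] by blast
    from choice[OF this]
    obtain y where y: "\<And>k. y k \<in> C" "\<And>k. norm (y k - x (enumerate ?N k)) \<le> \<delta>"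
      by blast
    have "range y \<in> \<beta>"
      using b C y(1) unfolding bornology_def by (metis empty_not_UNIV image_is_empty image_subsetI)
    then show False
      using sep strict_mono_enumerate[OF inf] y(2) by blast
  qed
  have "finite {n. norm (x n) \<le> \<delta>}"
    using fin[OF bornology_singleton[OF b, of 0]] by simp
  then obtain m where m: "\<And>n. norm (x n) \<le> \<delta> \<Longrightarrow> n < m"
    using finite_nat_set_iff_bounded by auto
  show ?thesis
  \<comment> \<open>The shift drops all terms of norm at most \<delta>. Being injective, it keeps
    the index sets finite.\<close>
  proof (rule that[of "\<lambda>n. x (n + m)" \<delta>])
    show "range (\<lambda>n. x (n + m)) \<subseteq> A" using x(1) by auto
    show "norm (x (n + m)) > \<delta>" for n using m[of "n + m"] by force
    show "finite {n. \<exists>c\<in>C. norm (c - x (n + m)) \<le> \<delta>}" if "C \<in> \<beta>" for C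
      using finite_vimageI[OF fin[OF that], of "\<lambda>n. n + m"] by (simp add: vimage_def inj_on_def)
  qed (rule x(2))
qed

text \<open>Height and distance of the apex from \<open>x\<close> shrink by the same factor, so cone
  \<open>n\<close> is a rescaled copy of the cone of height \<delta> over \<open>v n\<close>.
  \<open>Suc n\<close> avoids the scale 1/0.\<close>

definition cone_sup :: "real \<Rightarrow> 'a::real_normed_vector \<Rightarrow> (nat \<Rightarrow> 'a) \<Rightarrow> 'a \<Rightarrow> real" where
  "cone_sup \<delta> x v z =
     (SUP n. max 0 (\<delta> / real (Suc n) - norm (z - (x + v n /\<^sub>R real (Suc n)))))"

text \<open>All heights are at most \<delta>, which makes the real supremum in
  \<open>cone_sup\<close> meaningful.\<close>

lemma bdd_above_cone_sup:
  assumes "\<delta> > 0"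
  shows "bdd_above (range (\<lambda>n. max 0 (\<delta> / real (Suc n) - norm (z - (x + v n /\<^sub>R real (Suc n))))))"
proof (rule bdd_aboveI2)
  fix n
  have "\<delta> / real (Suc n) \<le> \<delta>" using assms by (simp add: divide_simps)
  then show "max 0 (\<delta> / real (Suc n) - norm (z - (x + v n /\<^sub>R real (Suc n)))) \<le> \<delta>"
    using assms norm_ge_zero[of "z - (x + v n /\<^sub>R real (Suc n))"] by linarith
qed

lemma cone_sup_nonneg:
  assumes "\<delta> > 0"
  shows "0 \<le> cone_sup \<delta> x v z"
  unfolding cone_sup_def
  by (rule cSUP_upper2[where x = 0, OF bdd_above_cone_sup[OF assms] UNIV_I]) simp

lemma cone_sup_apex:
  assumes "\<delta> > 0"
  shows "\<delta> / real (Suc n) \<le> cone_sup \<delta> x v (x + v n /\<^sub>R real (Suc n))"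
  unfolding cone_sup_def
  by (rule cSUP_upper2[where x = n, OF bdd_above_cone_sup[OF assms] UNIV_I]) simp

lemma lipschitz_on_cone_sup:
  assumes "\<delta> > 0"
  shows "1-lipschitz_on UNIV (cone_sup \<delta> x v)"
  unfolding cone_sup_def
proof (rule lipschitz_on_SUP[OF _ bdd_above_cone_sup[OF assms]])
  fix n
  show "1-lipschitz_on UNIV (\<lambda>z. max 0 (\<delta> / real (Suc n) - norm (z - (x + v n /\<^sub>R real (Suc n)))))"
  proof (rule lipschitz_onI)
    fix z w :: 'a
    let ?p = "x + v n /\<^sub>R real (Suc n)"
    have "\<bar>norm (z - ?p) - norm (w - ?p)\<bar> \<le> norm (z - w)"
      using norm_triangle_ineq3[of "z - ?p" "w - ?p"] by simp
    then show "dist (max 0 (\<delta> / real (Suc n) - norm (z - ?p)))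
        (max 0 (\<delta> / real (Suc n) - norm (w - ?p))) \<le> 1 * dist z w"
      unfolding dist_real_def dist_norm[of z w] by linarith
  qed simp
qed auto

text \<open>For directions in \<open>B\<close> and tolerance \<open>e\<close>, the cones are split
  by a finite index set \<open>N\<close>: those in \<open>N\<close> vanish for small
  \<open>t\<close> by \<open>far\<close>, and the others never exceed
  \<open>e * \<bar>t\<bar>\<close>.\<close>

lemma has_born_deriv_cone_sup:
  fixes \<beta> :: "'a::real_normed_vector set set"
  assumes v: "vector_bornology \<beta>" and \<delta>: "\<delta> > 0" and far: "\<And>n. norm (v n) > \<delta>"
    and sep: "\<And>C. C \<in> \<beta> \<Longrightarrow> finite {n. \<exists>c\<in>C. norm (c - v n) \<le> \<delta>}"
  shows "cone_sup \<delta> x v x = 0" "has_born_deriv \<beta> (cone_sup \<delta> x v) x (\<lambda>_. 0)"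
proof -
  have b: "bornology \<beta>" using v by (simp add: vector_bornology_def)
  have scale: "\<delta> / real (Suc n) - norm (x + w - (x + v n /\<^sub>R real (Suc n)))
      = (\<delta> - norm (real (Suc n) *\<^sub>R w - v n)) / real (Suc n)" for n w
  proof -
    have "real (Suc n) *\<^sub>R (x + w - (x + v n /\<^sub>R real (Suc n))) = real (Suc n) *\<^sub>R w - v n"
      by (simp add: scaleR_diff_right del: of_nat_Suc)
    then have "norm (real (Suc n) *\<^sub>R w - v n)
        = real (Suc n) * norm (x + w - (x + v n /\<^sub>R real (Suc n)))"
      by (metis abs_of_nat norm_scaleR)
    then show ?thesis by (simp add: field_simps del: of_nat_Suc)
  qed
  have cone_le: "cone_sup \<delta> x v (x + w) \<le> e" if "e \<ge> 0"
    "\<And>n. (\<delta> - norm (real (Suc n) *\<^sub>R w - v n)) / real (Suc n) \<le> e" for w e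
    unfolding cone_sup_def scale using that by (intro cSUP_least) auto
  have "cone_sup \<delta> x v (x + 0) \<le> 0"
  proof (rule cone_le)
    show "(\<delta> - norm (real (Suc n) *\<^sub>R 0 - v n)) / real (Suc n) \<le> 0" for n
      using far[of n] by (simp add: divide_nonpos_pos del: of_nat_Suc)
  qed simp
  then show zero: "cone_sup \<delta> x v x = 0"
    using cone_sup_nonneg[OF \<delta>, of x v x] by simp
  have "uniform_limit B (\<lambda>t u. (cone_sup \<delta> x v (x + t *\<^sub>R u) - cone_sup \<delta> x v x) /\<^sub>R t) (\<lambda>_. 0) (at 0)"
    if B: "B \<in> \<beta>" for B
  proof (rule uniform_limitI)
    fix e' :: real assume "e' > 0"
    \<comment> \<open>Bounding a supremum gives only a weak inequality; halving recovers the strict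
      one.\<close>
    define e where "e = e' / 2"
    have e: "e > 0" "e < e'" using \<open>e' > 0\<close> by (auto simp: e_def)
    \<comment> \<open>This set contains every multiple of a vector of \<open>B\<close> by a factor
      of modulus at most \<open>\<delta> / e\<close>. It depends on neither \<open>t\<close> nor
      \<open>n\<close>, so a single application of \<open>sep\<close> suffices.\<close>
    define C where "C = (\<lambda>a. (\<delta> / e) *\<^sub>R a) ` bal B"
    define N where "N = {n. \<exists>c\<in>C. norm (c - v n) \<le> \<delta>}"
    have "C \<in> \<beta>" unfolding C_def by (intro vector_bornologyD[OF v] B)
    then have N: "finite N" unfolding N_def by (rule sep)
    obtain M where M: "M > 0" "\<And>u. u \<in> B \<Longrightarrow> norm u \<le> M"
      using b B unfolding bornology_def by (meson bounded_pos)
    \<comment> \<open>Under this bound \<open>real (Suc n) *\<^sub>R t *\<^sub>R u\<close> stays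
      outside the \<delta>-ball around \<open>v n\<close>, so cone \<open>n\<close> contributes
      nothing.\<close>
    have "\<forall>\<^sub>F t in at 0. \<bar>t\<bar> * (real (Suc n) * M) < norm (v n) - \<delta>" for n
    proof (rule order_tendstoD)
      show "((\<lambda>t::real. \<bar>t\<bar> * (real (Suc n) * M)) \<longlongrightarrow> 0) (at 0)"
        by (auto intro!: tendsto_eq_intros)
    qed (use far in simp)
    then have "\<forall>\<^sub>F t in at 0. \<forall>n\<in>N. \<bar>t\<bar> * (real (Suc n) * M) < norm (v n) - \<delta>"
      using N by (simp add: eventually_ball_finite)
    moreover have "\<forall>\<^sub>F t in at 0. t \<noteq> (0::real)" by (simp add: eventually_at_filter)
    ultimately show "\<forall>\<^sub>F t in at 0. \<forall>u\<in>B.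
        dist ((cone_sup \<delta> x v (x + t *\<^sub>R u) - cone_sup \<delta> x v x) /\<^sub>R t) 0 < e'"
    proof eventually_elim
      case (elim t)
      show ?case
      proof
        fix u assume u: "u \<in> B"
        have "cone_sup \<delta> x v (x + t *\<^sub>R u) \<le> e * \<bar>t\<bar>"
        proof (rule cone_le)
          show "0 \<le> e * \<bar>t\<bar>" using e by simp
          fix n
          let ?h = "\<delta> - norm (real (Suc n) *\<^sub>R t *\<^sub>R u - v n)"
          show "?h / real (Suc n) \<le> e * \<bar>t\<bar>"
          proof (cases "n \<in> N")
            case True
            have "norm (real (Suc n) *\<^sub>R t *\<^sub>R u) = \<bar>t\<bar> * (real (Suc n) * norm u)"
              by (simp add: abs_mult del: of_nat_Suc)
            also have "\<dots> \<le> \<bar>t\<bar> * (real (Suc n) * M)"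
              using M(2)[OF u] by (intro mult_left_mono) auto
            also have "\<dots> < norm (v n) - \<delta>" using elim(1) True by blast
            finally have "?h \<le> 0"
              using norm_triangle_ineq2[of "v n" "real (Suc n) *\<^sub>R t *\<^sub>R u"]
              by (simp add: norm_minus_commute)
            then have "?h / real (Suc n) \<le> 0" by (rule divide_nonpos_pos) simp
            also have "0 \<le> e * \<bar>t\<bar>" using e by simp
            finally show ?thesis .
          next
            case False
            show ?thesis
            proof (rule ccontr)
              assume "\<not> ?h / real (Suc n) \<le> e * \<bar>t\<bar>"
              then have h: "e * \<bar>t\<bar> * real (Suc n) < ?h"
                by (simp add: divide_simps del: of_nat_Suc)
              moreover have "0 \<le> e * \<bar>t\<bar> * real (Suc n)" using e by simp
              ultimately have close: "norm (real (Suc n) *\<^sub>R t *\<^sub>R u - v n) \<le> \<delta>" by linarith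
              \<comment> \<open>Chosen so that scaling by \<open>\<delta> / e\<close> returns
                \<open>real (Suc n) *\<^sub>R t *\<^sub>R u\<close>. Since \<open>?h\<close> is at
                most \<delta>, a cone value above \<open>e * \<bar>t\<bar>\<close> forces modulus at
                most 1.\<close>
              let ?\<mu> = "real (Suc n) * t * e / \<delta>"
              have "e * \<bar>t\<bar> * real (Suc n) \<le> \<delta>"
                using h norm_ge_zero[of "real (Suc n) *\<^sub>R t *\<^sub>R u - v n"] by linarith
              then have "\<bar>?\<mu>\<bar> \<le> 1"
                using e \<delta> by (simp add: abs_mult mult_ac del: of_nat_Suc)
              then have "?\<mu> *\<^sub>R u \<in> bal B" using u unfolding bal_def by blast
              then have "(\<delta> / e) *\<^sub>R ?\<mu> *\<^sub>R u \<in> C" unfolding C_def by blast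
              moreover have "(\<delta> / e) *\<^sub>R ?\<mu> *\<^sub>R u = real (Suc n) *\<^sub>R t *\<^sub>R u"
                using e \<delta> by simp
              ultimately have "n \<in> N" unfolding N_def using close by auto
              with False show False by blast
            qed
          qed
        qed
        then have "cone_sup \<delta> x v (x + t *\<^sub>R u) / \<bar>t\<bar> \<le> e"
          using elim(2) by (simp add: divide_simps)
        then show "dist ((cone_sup \<delta> x v (x + t *\<^sub>R u) - cone_sup \<delta> x v x) /\<^sub>R t) 0 < e'"
          using e cone_sup_nonneg[OF \<delta>, of x v "x + t *\<^sub>R u"]
          by (simp add: zero abs_mult divide_inverse mult.commute)
      qed
    qed
  qed
  then show "has_born_deriv \<beta> (cone_sup \<delta> x v) x (\<lambda>_. 0)"
    unfolding has_born_deriv_iff_uniform_limit[OF b] by simp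
qed

section \<open>The operator property from the cone function, and the equivalences\<close>

lemma bornology_operator_if_lipschitz_test:
  fixes \<beta>X :: "'x::real_normed_vector set set" and \<beta>Y :: "'y::real_normed_vector set set"
  assumes vX: "vector_bornology \<beta>X" and bY: "bornology \<beta>Y" and S: "property_S \<beta>X"
    and T: "has_ph_deriv \<beta>Y T y R"
    and test: "\<And>f :: 'x \<Rightarrow> real. 1-lipschitz_on UNIV f \<Longrightarrow> has_born_deriv \<beta>X f (T y) (\<lambda>_. 0) \<Longrightarrow>
      has_born_deriv \<beta>Y (f \<circ> T) y (\<lambda>_. 0)"
  shows "bornology_operator \<beta>Y \<beta>X R"
  unfolding bornology_operator_def
proof (rule ballI, rule ccontr)
  fix A assume A: "A \<in> \<beta>Y" and nin: "R ` A \<notin> \<beta>X"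
  have bX: "bornology \<beta>X"
    using vX by (simp add: vector_bornology_def)
  have "A \<noteq> {}" "bounded A" using bY A by (auto simp: bornology_def)
  then have RA: "R ` A \<noteq> {}" "bounded (R ` A)"
    using T by (auto simp: has_ph_deriv_def intro: positively_homogeneous_bounded_image)
  obtain v :: "nat \<Rightarrow> 'x" and \<delta> where v: "range v \<subseteq> R ` A" and \<delta>: "\<delta> > 0" and far: "\<And>n. norm (v n) > \<delta>"
    and sep: "\<And>C. C \<in> \<beta>X \<Longrightarrow> finite {n. \<exists>c\<in>C. norm (c - v n) \<le> \<delta>}"
    by (rule property_S_separated_sequence[OF bX S RA nin]) (rule that)
  have "\<forall>n. \<exists>u\<in>A. v n = R u" using v by blast
  then obtain u where u: "\<And>n. u n \<in> A" "\<And>n. v n = R (u n)" by metis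
  define f where "f = cone_sup \<delta> (T y) v"
  have lip: "1-lipschitz_on UNIV f" unfolding f_def by (rule lipschitz_on_cone_sup[OF \<delta>])
  have f0: "f (T y) = 0" and "has_born_deriv \<beta>X f (T y) (\<lambda>_. 0)"
    unfolding f_def using has_born_deriv_cone_sup[OF vX \<delta> far sep] by auto
  then have "has_ph_deriv \<beta>Y (f \<circ> T) y (\<lambda>_. 0)"
    using test[OF lip] has_born_deriv_imp_has_ph_deriv[OF bY] by blast
  then have "\<forall>\<^sub>F t in at_right 0. \<forall>u\<in>A. dist ((f (T (y + t *\<^sub>R u)) - f (T y)) /\<^sub>R t) 0 < \<delta> / 2"
    using A half_gt_zero[OF \<delta>] unfolding has_ph_deriv_iff_uniform_limit[OF bY] uniform_limit_iff
      o_def by blast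
  moreover have "\<forall>\<^sub>F t in at_right 0. \<forall>u\<in>A. dist ((T (y + t *\<^sub>R u) - T y) /\<^sub>R t) (R u) < \<delta> / 2"
    using T A half_gt_zero[OF \<delta>] unfolding has_ph_deriv_iff_uniform_limit[OF bY] uniform_limit_iff
    by blast
  \<comment> \<open>Uniformity over \<open>A\<close> is decisive: below, the index \<open>n\<close>
    fixes both the scale and the direction \<open>u n\<close>, so pointwise convergence would not
    do.\<close>
  ultimately have "\<forall>\<^sub>F t in at_right 0. \<forall>u\<in>A.
      dist ((f (T (y + t *\<^sub>R u)) - f (T y)) /\<^sub>R t) 0 < \<delta> / 2 \<and>
      dist ((T (y + t *\<^sub>R u) - T y) /\<^sub>R t) (R u) < \<delta> / 2"
    by eventually_elim blast
  then have "\<forall>\<^sub>F n in sequentially. \<forall>u\<in>A.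
      dist ((f (T (y + inverse (real (Suc n)) *\<^sub>R u)) - f (T y)) /\<^sub>R inverse (real (Suc n))) 0 < \<delta> / 2 \<and>
      dist ((T (y + inverse (real (Suc n)) *\<^sub>R u) - T y) /\<^sub>R inverse (real (Suc n))) (R u) < \<delta> / 2"
  proof (rule eventually_compose_filterlim)
    show "filterlim (\<lambda>n. inverse (real (Suc n))) (at_right 0) sequentially"
      unfolding filterlim_at using LIMSEQ_inverse_real_of_nat by auto
  qed
  then obtain n where n:
      "\<And>u. u \<in> A \<Longrightarrow> dist ((f (T (y + inverse (real (Suc n)) *\<^sub>R u)) - f (T y)) /\<^sub>R inverse (real (Suc n))) 0 < \<delta> / 2"
      "\<And>u. u \<in> A \<Longrightarrow> dist ((T (y + inverse (real (Suc n)) *\<^sub>R u) - T y) /\<^sub>R inverse (real (Suc n))) (R u) < \<delta> / 2"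
    using eventually_happens by (metis (no_types, lifting) sequentially_bot)
  define t where "t = inverse (real (Suc n))"
  have t: "t > 0" by (simp add: t_def)
  let ?p = "(f (T (y + t *\<^sub>R u n)) - f (T y)) /\<^sub>R t"
    and ?q = "(f (T y + t *\<^sub>R R (u n)) - f (T y)) /\<^sub>R t"
  have "dist ?p ?q \<le> 1 * dist ((T (y + t *\<^sub>R u n) - T y) /\<^sub>R t) (R (u n))"
    using lip t by (rule lipschitz_quotient_dist)
  moreover have "dist ?p 0 < \<delta> / 2" "dist ((T (y + t *\<^sub>R u n) - T y) /\<^sub>R t) (R (u n)) < \<delta> / 2"
    using n[OF u(1)] unfolding t_def by auto
  ultimately have "?q < \<delta>" by (simp add: dist_real_def)
  \<comment> \<open>The argument is exactly the apex of cone \<open>n\<close>, whose height is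
    \<open>\<delta> * t\<close>. The quotient \<open>?q\<close> is thus at least \<delta>, while the
    two errors below \<open>\<delta> / 2\<close> force it under \<delta>.\<close>
  moreover have "\<delta> * t \<le> f (T y + t *\<^sub>R R (u n))"
    using cone_sup_apex[OF \<delta>, of n "T y" v] by (simp add: f_def u(2) t_def divide_inverse)
  then have "\<delta> \<le> ?q" using t by (simp add: f0 field_simps)
  ultimately show False by simp
qed

theorem theorem4p5:
  fixes \<beta>X :: "'x::banach set set" and \<beta>Y :: "'y::banach set set"
    and T :: "'y \<Rightarrow> 'x" and y :: 'y
  assumes "vector_bornology \<beta>X" and "vector_bornology \<beta>Y"
    and "property_S \<beta>X"
    and "ph_differentiable \<beta>Y T y"
  shows
    "(bornology_operator \<beta>Y \<beta>X (ph_deriv \<beta>Y T y)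
      \<longleftrightarrow>
      (\<forall>f :: 'x \<Rightarrow> real. (\<exists>L. L-lipschitz_on UNIV f) \<and> ph_differentiable \<beta>X f (T y) \<longrightarrow>
         ph_differentiable \<beta>Y (f \<circ> T) y \<and>
         ph_deriv \<beta>Y (f \<circ> T) y = ph_deriv \<beta>X f (T y) \<circ> ph_deriv \<beta>Y T y))
     \<and>
     (bornology_operator \<beta>Y \<beta>X (ph_deriv \<beta>Y T y)
      \<longleftrightarrow>
      (\<forall>f :: 'x \<Rightarrow> real. (\<exists>L. L-lipschitz_on UNIV f) \<and> born_differentiable \<beta>X f (T y) \<and>
         born_deriv \<beta>X f (T y) = (\<lambda>_. 0) \<longrightarrow>
         born_differentiable \<beta>Y (f \<circ> T) y \<and> born_deriv \<beta>Y (f \<circ> T) y = (\<lambda>_. 0)))"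
  (is "(?i \<longleftrightarrow> ?ii) \<and> (?i \<longleftrightarrow> ?iii)")
proof -
  have bX: "bornology \<beta>X" and bY: "bornology \<beta>Y"
    using assms(1,2) by (auto simp: vector_bornology_def)
  define R where "R = ph_deriv \<beta>Y T y"
  have T: "has_ph_deriv \<beta>Y T y R"
    using assms(4) ph_deriv_eqI[OF bY] unfolding ph_differentiable_def R_def by metis
  have 1: ?ii if ?i
  proof (intro allI impI)
    fix f :: "'x \<Rightarrow> real"
    assume "(\<exists>L. L-lipschitz_on UNIV f) \<and> ph_differentiable \<beta>X f (T y)"
    then obtain L F where L: "L-lipschitz_on UNIV f" and F: "has_ph_deriv \<beta>X f (T y) F"
      unfolding ph_differentiable_def by blast
    have "has_ph_deriv \<beta>Y (f \<circ> T) y (F \<circ> R)"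
      using has_ph_deriv_compose[OF bX bY _ L T F] that by (simp add: R_def)
    then show "ph_differentiable \<beta>Y (f \<circ> T) y \<and>
        ph_deriv \<beta>Y (f \<circ> T) y = ph_deriv \<beta>X f (T y) \<circ> ph_deriv \<beta>Y T y"
      using ph_deriv_eqI[OF bY] ph_deriv_eqI[OF bX F]
      unfolding ph_differentiable_def R_def by metis
  qed
  have 2: ?iii if ?ii
  proof (intro allI impI)
    fix f :: "'x \<Rightarrow> real"
    assume f: "(\<exists>L. L-lipschitz_on UNIV f) \<and> born_differentiable \<beta>X f (T y) \<and>
      born_deriv \<beta>X f (T y) = (\<lambda>_. 0)"
    then have "has_born_deriv \<beta>X f (T y) (\<lambda>_. 0)"
      using born_deriv_eqI[OF bX] unfolding born_differentiable_def by metis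
    then have F: "has_ph_deriv \<beta>X f (T y) (\<lambda>_. 0)"
      by (rule has_born_deriv_imp_has_ph_deriv[OF bX])
    \<comment> \<open>Here (ii) is used with derivative 0. Composing it with \<open>R\<close> gives
      0 again, which is linear, so the one-sided derivative becomes a two-sided one.\<close>
    then have "ph_differentiable \<beta>Y (f \<circ> T) y \<and> ph_deriv \<beta>Y (f \<circ> T) y = (\<lambda>_. 0) \<circ> R"
      using that f ph_deriv_eqI[OF bX F] unfolding ph_differentiable_def R_def by metis
    then have "has_ph_deriv \<beta>Y (f \<circ> T) y (\<lambda>_. 0)"
      using ph_deriv_eqI[OF bY] unfolding ph_differentiable_def by (metis comp_apply ext)
    then have "has_born_deriv \<beta>Y (f \<circ> T) y (\<lambda>_. 0)"
      by (rule has_ph_deriv_imp_has_born_deriv[OF assms(2)]) simp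
    then show "born_differentiable \<beta>Y (f \<circ> T) y \<and> born_deriv \<beta>Y (f \<circ> T) y = (\<lambda>_. 0)"
      using born_deriv_eqI[OF bY] unfolding born_differentiable_def by blast
  qed
  have 3: ?i if iii: ?iii
    unfolding R_def[symmetric]
  proof (rule bornology_operator_if_lipschitz_test[OF assms(1) bY assms(3) T])
    fix f :: "'x \<Rightarrow> real"
    assume "1-lipschitz_on UNIV f" and D: "has_born_deriv \<beta>X f (T y) (\<lambda>_. 0)"
    then have "born_differentiable \<beta>Y (f \<circ> T) y \<and> born_deriv \<beta>Y (f \<circ> T) y = (\<lambda>_. 0)"
      using iii born_deriv_eqI[OF bX D] unfolding born_differentiable_def by blast
    then show "has_born_deriv \<beta>Y (f \<circ> T) y (\<lambda>_. 0)"
      using born_deriv_eqI[OF bY] unfolding born_differentiable_def by metis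
  qed
  show ?thesis using 1 2 3 by blast
qed

end
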